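(* Let $A\in\mathbb{R}^{p\times m}$, $B\in\mathbb{R}^{n\times q}$, $C\in\mathbb{R}^{p\times q}$ be such that $AXB=C$ is consistent, and let $X^*\in\mathbb{R}^{m\times n}$ satisfy $AX^*B=C$. Assume that $(S,P)$ is a complete discrete sampling pair, with $S=S_i$ with probability $p_i^1$ ($i=1,\dots,r_1$) and $P=P_j$ with probability $p_j^2$ ($j=1,\dots,r_2$), where $$p_i^1=\frac{\mathrm{Tr}(S_i^\top AA^\top S_i)}{\|A^\top\mathbf{S}\|_F^2},\quad i=1,\dots,r_1,\qquad p_j^2=\frac{\mathrm{Tr}(P_j^\top B^\top BP_j)}{\|B\mathbf{P}\|_F^2},\quad j=1,\dots,r_2,$$ with $\mathbf{S}=[S_1,\dots,S_{r_1}]$ and $\mathbf{P}=[P_1,\dots,P_{r_2}]$. Then the sequence $(X^k)_{k\ge0}$ generated from an arbitrary (deterministic) $X^0\in\mathbb{R}^{m\times n}$ by $$X^{k+1}=X^k-A^\top S(S^\top AA^\top S)^\dagger S^\top(AX^kB-C)P(P^\top B^\top BP)^\dagger P^\top B^\top$$ satisfies, for every $k\ge 0$, $$\mathbf{E}\left[\|X^k-X^*\|_F^2\right]\le\rho^k\,\|X^0-X^*\|_F^2,$$ where $$\rho=1-\frac{\lambda_{\min}(\mathbf{S}^\top AA^\top\mathbf{S})\,\lambda_{\min}(\mathbf{P}^\top B^\top B\mathbf{P})}{\|A^\top\mathbf{S}\|_F^2\,\|B\mathbf{P}\|_F^2}.$$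
   Context: Complete discrete sampling pair: $S$ and $P$ are random matrices with discrete distributions such that (i) $S=S_i\in\mathbb{R}^{p\times\tau_{1i}}$ with probability $p_i^1>0$, where $S_i^\top A$ has full row rank and $\tau_{1i}\in\mathbb{N}$ for $i=1,\dots,r_1$, and $\mathbf{S}=[S_1,\dots,S_{r_1}]\in\mathbb{R}^{p\times\sum_i\tau_{1i}}$ is such that $A^\top\mathbf{S}$ has full row rank; (ii) $P=P_j\in\mathbb{R}^{q\times\tau_{2j}}$ with probability $p_j^2>0$, where $P_j^\top B^\top$ has full row rank and $\tau_{2j}\in\mathbb{N}$ for $j=1,\dots,r_2$, and $\mathbf{P}=[P_1,\dots,P_{r_2}]\in\mathbb{R}^{q\times\sum_j\tau_{2j}}$ is such that $B\mathbf{P}$ has full row rank. At each iteration $S$ and $P$ are drawn independently of each other and of the previous iterations, from these distributions. $\dagger$ is the Moore-Penrose pseudoinverse, $\|\cdot\|_F$ the Frobenius norm, $\lambda_{\min}$ the smallest eigenvalue. *)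

theory Defs
  imports
    "HOL-Probability.Probability"
    "Jordan_Normal_Form.Spectral_Radius"
    "Jordan_Normal_Form.DL_Rank"
begin

definition frobenius_norm :: "real mat \<Rightarrow> real" where
  "frobenius_norm M = sqrt (\<Sum>i<dim_row M. \<Sum>j<dim_col M. (M $$ (i, j))\<^sup>2)"

definition mat_trace :: "real mat \<Rightarrow> real" where
  "mat_trace M = (\<Sum>i<dim_row M. M $$ (i, i))"

text \<open>Only meant for symmetric matrices with at least one row, whose spectrum is a nonempty finite
  set of reals.\<close>
definition lambda_min :: "real mat \<Rightarrow> real" where
  "lambda_min M = Min (spectrum M)"

definition full_row_rank :: "real mat \<Rightarrow> bool" where
  "full_row_rank M \<longleftrightarrow> vec_space.rank (dim_row M) M = dim_row M"

definition penrose_inverse :: "real mat \<Rightarrow> real mat \<Rightarrow> bool" where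
  "penrose_inverse M N \<longleftrightarrow>
     N \<in> carrier_mat (dim_col M) (dim_row M) \<and>
     M * N * M = M \<and> N * M * N = N \<and>
     (M * N)\<^sup>T = M * N \<and> (N * M)\<^sup>T = N * M"

lemma penrose_inverse_unique:
  assumes "penrose_inverse M N" "penrose_inverse M K"
  shows "N = K"
proof -
  define a b where "a = dim_row M" and "b = dim_col M"
  have M: "M \<in> carrier_mat a b" by (auto simp: a_def b_def)
  have N: "N \<in> carrier_mat b a" and K: "K \<in> carrier_mat b a"
    using assms by (auto simp: penrose_inverse_def a_def b_def)
  have n: "M * N * M = M" "N * M * N = N" "(M * N)\<^sup>T = M * N" "(N * M)\<^sup>T = N * M"
    and k: "M * K * M = M" "K * M * K = K" "(M * K)\<^sup>T = M * K" "(K * M)\<^sup>T = K * M"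
    using assms by (auto simp: penrose_inverse_def)
  have MN: "M * N \<in> carrier_mat a a" and MK: "M * K \<in> carrier_mat a a"
    and NM: "N * M \<in> carrier_mat b b" and KM: "K * M \<in> carrier_mat b b"
    using M N K by auto
  have "M * K * (M * N) = M * N"
    using assoc_mult_mat[OF MK M N] k(1) by simp
  then have "(M * K * (M * N))\<^sup>T = (M * N)\<^sup>T" by simp
  then have "M * N * (M * K) = M * N"
    using transpose_mult[OF MK MN] n(3) k(3) by simp
  moreover have "M * N * (M * K) = M * K"
    using assoc_mult_mat[OF MN M K] n(1) by simp
  ultimately have l: "M * N = M * K" by simp
  have "N * M * (K * M) = N * M"
    using assoc_mult_mat[OF N M KM] assoc_mult_mat[OF M K M] k(1) by simp
  then have "(N * M * (K * M))\<^sup>T = (N * M)\<^sup>T" by simp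
  then have "K * M * (N * M) = N * M"
    using transpose_mult[OF NM KM] n(4) k(4) by simp
  moreover have "K * M * (N * M) = K * M"
    using assoc_mult_mat[OF K M NM] assoc_mult_mat[OF M N M] n(1) by simp
  ultimately have r: "N * M = K * M" by simp
  have "N = K * M * N" using n(2) r by simp
  also have "\<dots> = K * (M * K)" using assoc_mult_mat[OF K M N] l by simp
  also have "\<dots> = K" using assoc_mult_mat[OF K M K] k(2) by simp
  finally show ?thesis .
qed

text \<open>The Moore--Penrose pseudoinverse.\<close>
definition pinv :: "real mat \<Rightarrow> real mat" where
  "pinv M = (THE N. penrose_inverse M N)"

text \<open>The block row \<open>[S\<^sub>0, \<dots>, S\<^bsub>r-1\<^esub>]\<close> of matrices with \<open>d\<close> rows each.\<close>
definition block_row :: "nat \<Rightarrow> nat \<Rightarrow> (nat \<Rightarrow> real mat) \<Rightarrow> real mat" where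
  "block_row d r Ss = mat_of_cols d (concat (map (\<lambda>i. cols (Ss i)) [0..<r]))"

text \<open>The blocks are indexed from 0. A random matrix that equals \<open>Ss i\<close> with probability \<open>p1 i\<close>
  is represented as \<open>Ss \<iota>\<close> for a random index \<open>\<iota>\<close> that equals \<open>i\<close> with probability \<open>p1 i\<close>; this
  also makes sense when some of the blocks coincide.\<close>
definition complete_discrete_sampling ::
  "real mat \<Rightarrow> real mat \<Rightarrow>
   nat \<Rightarrow> (nat \<Rightarrow> nat) \<Rightarrow> (nat \<Rightarrow> real mat) \<Rightarrow> (nat \<Rightarrow> real) \<Rightarrow>
   nat \<Rightarrow> (nat \<Rightarrow> nat) \<Rightarrow> (nat \<Rightarrow> real mat) \<Rightarrow> (nat \<Rightarrow> real) \<Rightarrow> bool" where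
  "complete_discrete_sampling A B r1 \<tau>1 Ss p1 r2 \<tau>2 Ps p2 \<longleftrightarrow>
     (\<forall>i<r1. 0 < \<tau>1 i \<and> Ss i \<in> carrier_mat (dim_row A) (\<tau>1 i) \<and>
             full_row_rank ((Ss i)\<^sup>T * A) \<and> 0 < p1 i) \<and>
     (\<Sum>i<r1. p1 i) = 1 \<and>
     full_row_rank (A\<^sup>T * block_row (dim_row A) r1 Ss) \<and>
     (\<forall>j<r2. 0 < \<tau>2 j \<and> Ps j \<in> carrier_mat (dim_col B) (\<tau>2 j) \<and>
             full_row_rank ((Ps j)\<^sup>T * B\<^sup>T) \<and> 0 < p2 j) \<and>
     (\<Sum>j<r2. p2 j) = 1 \<and>
     full_row_rank (B * block_row (dim_col B) r2 Ps)"

definition sampling_step ::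
  "real mat \<Rightarrow> real mat \<Rightarrow> real mat \<Rightarrow> real mat \<Rightarrow> real mat \<Rightarrow> real mat \<Rightarrow> real mat" where
  "sampling_step A B C S P X =
     X - A\<^sup>T * S * pinv (S\<^sup>T * A * A\<^sup>T * S) * S\<^sup>T * (A * X * B - C)
           * P * pinv (P\<^sup>T * B\<^sup>T * B * P) * P\<^sup>T * B\<^sup>T"

end

theory Submission
  imports Defs
begin

unbundle no inner_syntax

text \<open>With \<open>Y = X - X\<^sup>*\<close>, one step replaces \<open>Y\<close> by \<open>Y - \<Phi> Y \<Psi>\<close>, where \<open>\<Phi>\<close> and \<open>\<Psi>\<close> are the
  orthogonal projections onto the column spaces of \<open>A\<^sup>T S\<close> and \<open>B P\<close>. By Pythagoras the squared norm
  drops by exactly that of \<open>\<Phi> Y \<Psi>\<close>. For \<open>V = A\<^sup>T S\<^sub>i\<close> one has \<open>V\<^sup>T \<Phi>\<^sub>i = V\<^sup>T\<close>, so the squared norm of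
  \<open>V\<^sup>T Y\<close> is at most that of \<open>V\<close> times that of \<open>\<Phi>\<^sub>i Y\<close>. With the given probabilities the weights cancel,
  and the sum over \<open>i\<close> of the squared norms of \<open>S\<^sub>i\<^sup>T A Y\<close> is the squared norm of \<open>W\<^sup>T Y\<close> for
  \<open>W = A\<^sup>T [S\<^sub>1, \<dots>, S\<^sub>r]\<close>, which the smallest eigenvalue of \<open>W\<^sup>T W\<close> bounds below. The same estimate
  applies to the right factor, independently of the left one.\<close>

section \<open>Quadratic forms and the smallest eigenvalue\<close>

text \<open>The premises mention only the three factors, so the equation can serve as a conditional
  rewrite rule; carrier premises would leave the dimensions as unknowns.\<close>

lemma mult_mat_assoc_dim:
  fixes A B C :: "real mat"
  assumes "dim_col A = dim_row B" "dim_col B = dim_row C"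
  shows "A * B * C = A * (B * C)"
  using assms by (intro assoc_mult_mat[of _ "dim_row A" "dim_row B" _ "dim_row C" _ "dim_col C"]) auto

lemma transpose_mult_dim:
  fixes A B :: "real mat"
  assumes "dim_col A = dim_row B"
  shows "(A * B)\<^sup>T = B\<^sup>T * A\<^sup>T"
  using assms by (intro transpose_mult[of _ "dim_row A" "dim_row B" _ "dim_col B"]) auto

lemma mult_mat_vec_assoc_dim:
  fixes A B :: "real mat"
  assumes "dim_col A = dim_row B" "dim_col B = dim_vec v"
  shows "A * B *\<^sub>v v = A *\<^sub>v (B *\<^sub>v v)"
  using assms by (intro assoc_mult_mat_vec[of _ "dim_row A" "dim_row B" _ "dim_vec v"])
    (auto intro: carrier_vecI)

lemma scalar_prod_transpose:
  fixes W :: "real mat"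
  assumes "W \<in> carrier_mat m n" "x \<in> carrier_vec m" "y \<in> carrier_vec n"
  shows "x \<bullet> (W *\<^sub>v y) = (W\<^sup>T *\<^sub>v x) \<bullet> y"
  using transpose_vec_mult_scalar[OF assms(1,3,2)] by simp

lemma scalar_prod_self_nonneg: "0 \<le> (x :: real vec) \<bullet> x"
  by (auto simp: scalar_prod_def intro!: sum_nonneg)

lemma scalar_prod_self_eq_0_iff:
  "x \<in> carrier_vec n \<Longrightarrow> (x :: real vec) \<bullet> x = 0 \<longleftrightarrow> x = 0\<^sub>v n"
  by (auto simp: scalar_prod_def sum_nonneg_eq_0_iff intro!: eq_vecI)

text \<open>A polynomial of degree at most 2 in \<open>t\<close> that is nonnegative everywhere has
  nonpositive discriminant. Semidefinite \<open>H\<close> is allowed because the shifted form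
  \<open>G - s \<cdot>\<^sub>m 1\<^sub>m n\<close> below is only known to be nonnegative.\<close>

lemma psd_Cauchy_Schwarz:
  fixes H :: "real mat"
  assumes H: "H \<in> carrier_mat n n" "H\<^sup>T = H"
    and psd: "\<And>z. z \<in> carrier_vec n \<Longrightarrow> 0 \<le> z \<bullet> (H *\<^sub>v z)"
    and x: "x \<in> carrier_vec n" and y: "y \<in> carrier_vec n"
  shows "(x \<bullet> (H *\<^sub>v y))\<^sup>2 \<le> (x \<bullet> (H *\<^sub>v x)) * (y \<bullet> (H *\<^sub>v y))"
proof -
  define a b c where "a = x \<bullet> (H *\<^sub>v x)" and "b = x \<bullet> (H *\<^sub>v y)" and "c = y \<bullet> (H *\<^sub>v y)"
  have b': "y \<bullet> (H *\<^sub>v x) = b"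
    using scalar_prod_transpose[OF H(1) y x] H x y comm_scalar_prod[of "H *\<^sub>v y" n x]
    by (simp add: b_def)
  have quad: "0 \<le> a + 2 * t * b + t\<^sup>2 * c" for t
  proof -
    have "H *\<^sub>v (x + t \<cdot>\<^sub>v y) = H *\<^sub>v x + t \<cdot>\<^sub>v (H *\<^sub>v y)"
      using H x y by (simp add: mult_add_distrib_mat_vec mult_mat_vec)
    then have "(x + t \<cdot>\<^sub>v y) \<bullet> (H *\<^sub>v (x + t \<cdot>\<^sub>v y)) = a + 2 * t * b + t\<^sup>2 * c"
      using H x y b'
      by (simp add: add_scalar_prod_distrib[of _ n] scalar_prod_add_distrib[of _ n]
          a_def b_def c_def power2_eq_square algebra_simps)
    with psd[of "x + t \<cdot>\<^sub>v y"] x y show ?thesis by simp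
  qed
  show ?thesis
  proof (cases "c = 0")
    case True
    have "b = 0"
    proof (rule ccontr)
      assume "b \<noteq> 0"
      \<comment> \<open>With \<open>c = 0\<close> the polynomial is \<open>a + 2 * t * b\<close>,
        and this \<open>t\<close> gives it the value -1.\<close>
      with quad[of "- (a + 1) / (2 * b)"] True show False by (simp add: field_simps)
    qed
    with True show ?thesis by (simp add: a_def b_def c_def)
  next
    case False
    moreover have "0 \<le> c" using psd y by (simp add: c_def)
    ultimately have c: "0 < c" by simp
    \<comment> \<open>The point \<open>t = - b / c\<close> minimizes the polynomial.\<close>
    have "0 \<le> a - b\<^sup>2 / c"
      using quad[of "- b / c"] c by (simp add: power2_eq_square field_simps)
    with c have "b\<^sup>2 \<le> a * c" by (simp add: field_simps)
    then show ?thesis by (simp add: a_def b_def c_def)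
  qed
qed

lemma scalar_prod_Cauchy_Schwarz:
  fixes x y :: "real vec"
  assumes "x \<in> carrier_vec n" "y \<in> carrier_vec n"
  shows "(x \<bullet> y)\<^sup>2 \<le> (x \<bullet> x) * (y \<bullet> y)"
  using psd_Cauchy_Schwarz[of "1\<^sub>m n" n x y] assms scalar_prod_self_nonneg by simp

section \<open>Frobenius norm and trace\<close>

lemma frobenius_norm_power2:
  "(frobenius_norm M)\<^sup>2 = (\<Sum>i<dim_row M. \<Sum>j<dim_col M. (M $$ (i, j))\<^sup>2)"
  unfolding frobenius_norm_def by (intro real_sqrt_pow2 sum_nonneg) auto

lemma frobenius_norm_power2_cols:
  "(frobenius_norm M)\<^sup>2 = (\<Sum>j<dim_col M. col M j \<bullet> col M j)"
proof -
  have "(frobenius_norm M)\<^sup>2 = (\<Sum>j<dim_col M. \<Sum>i<dim_row M. (M $$ (i, j))\<^sup>2)"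
    unfolding frobenius_norm_power2 by (rule sum.swap)
  also have "\<dots> = (\<Sum>j<dim_col M. col M j \<bullet> col M j)"
    by (auto simp: scalar_prod_def power2_eq_square atLeast0LessThan intro!: sum.cong)
  finally show ?thesis .
qed

lemma frobenius_norm_transpose [simp]: "frobenius_norm (M\<^sup>T) = frobenius_norm M"
  unfolding frobenius_norm_def by (subst sum.swap) simp

lemma mat_trace_transpose_mult:
  "mat_trace (M\<^sup>T * M) = (frobenius_norm M)\<^sup>2"
  unfolding frobenius_norm_power2_cols mat_trace_def by (auto intro!: sum.cong)

lemma mat_trace_mult_comm:
  assumes "M \<in> carrier_mat a b" "N \<in> carrier_mat b a"
  shows "mat_trace (M * N) = mat_trace (N * M)"
proof -
  have "mat_trace (M * N) = (\<Sum>i<a. \<Sum>j<b. M $$ (i, j) * N $$ (j, i))"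
    using assms by (auto simp: mat_trace_def scalar_prod_def atLeast0LessThan intro!: sum.cong)
  also have "\<dots> = (\<Sum>j<b. \<Sum>i<a. N $$ (j, i) * M $$ (i, j))"
    by (subst sum.swap) (simp add: mult.commute)
  also have "\<dots> = mat_trace (N * M)"
    using assms by (auto simp: mat_trace_def scalar_prod_def atLeast0LessThan intro!: sum.cong)
  finally show ?thesis .
qed

text \<open>Cauchy-Schwarz for each row of \<open>K\<close>; the squared lengths of the rows add up
  to the squared norm.\<close>

lemma mult_mat_vec_frobenius_le:
  assumes K: "K \<in> carrier_mat a b" and x: "x \<in> carrier_vec b"
  shows "(K *\<^sub>v x) \<bullet> (K *\<^sub>v x) \<le> (frobenius_norm K)\<^sup>2 * (x \<bullet> x)"
proof -
  have "(K *\<^sub>v x) \<bullet> (K *\<^sub>v x) = (\<Sum>i<a. (row K i \<bullet> x)\<^sup>2)"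
    using K x by (auto simp: scalar_prod_def power2_eq_square atLeast0LessThan intro!: sum.cong)
  also have "\<dots> \<le> (\<Sum>i<a. (row K i \<bullet> row K i) * (x \<bullet> x))"
    using K x by (intro sum_mono scalar_prod_Cauchy_Schwarz) auto
  also have "\<dots> = (\<Sum>i<a. row K i \<bullet> row K i) * (x \<bullet> x)"
    by (rule sum_distrib_right[symmetric])
  also have "(\<Sum>i<a. row K i \<bullet> row K i) = (frobenius_norm K)\<^sup>2"
    using K by (simp add: frobenius_norm_power2 scalar_prod_def atLeast0LessThan
        flip: power2_eq_square)
  finally show ?thesis .
qed

lemma frobenius_norm_mult_le:
  assumes K: "K \<in> carrier_mat a b" and Z: "Z \<in> carrier_mat b c"
  shows "(frobenius_norm (K * Z))\<^sup>2 \<le> (frobenius_norm K)\<^sup>2 * (frobenius_norm Z)\<^sup>2"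
proof -
  have "(frobenius_norm (K * Z))\<^sup>2 = (\<Sum>j<c. (K *\<^sub>v col Z j) \<bullet> (K *\<^sub>v col Z j))"
    unfolding frobenius_norm_power2_cols using K Z
    by (intro sum.cong) (simp_all only: carrier_matD index_mult_mat lessThan_iff col_mult2)
  also have "\<dots> \<le> (\<Sum>j<c. (frobenius_norm K)\<^sup>2 * (col Z j \<bullet> col Z j))"
    using K Z by (intro sum_mono mult_mat_vec_frobenius_le) auto
  also have "\<dots> = (frobenius_norm K)\<^sup>2 * (frobenius_norm Z)\<^sup>2"
    using Z by (simp add: frobenius_norm_power2_cols[of Z] sum_distrib_left)
  finally show ?thesis .
qed

text \<open>Cauchy-Schwarz followed by the vector bound. For \<open>G\<close> this gives a first
  lower bound of its form; for an inverse \<open>K\<close> it controls the gain in the argument by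
  contradiction below.\<close>

lemma quadratic_form_le_frobenius:
  assumes K: "K \<in> carrier_mat n n" and x: "x \<in> carrier_vec n"
  shows "\<bar>x \<bullet> (K *\<^sub>v x)\<bar> \<le> frobenius_norm K * (x \<bullet> x)"
proof (rule power2_le_imp_le)
  have "(x \<bullet> (K *\<^sub>v x))\<^sup>2 \<le> (x \<bullet> x) * ((K *\<^sub>v x) \<bullet> (K *\<^sub>v x))"
    using K x by (intro scalar_prod_Cauchy_Schwarz) auto
  also have "\<dots> \<le> (x \<bullet> x) * ((frobenius_norm K)\<^sup>2 * (x \<bullet> x))"
    by (intro mult_left_mono mult_mat_vec_frobenius_le[OF K x] scalar_prod_self_nonneg)
  finally show "\<bar>x \<bullet> (K *\<^sub>v x)\<bar>\<^sup>2 \<le> (frobenius_norm K * (x \<bullet> x))\<^sup>2"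
    by (simp add: power2_eq_square algebra_simps)
  show "0 \<le> frobenius_norm K * (x \<bullet> x)"
    by (auto simp: frobenius_norm_def intro!: mult_nonneg_nonneg scalar_prod_self_nonneg sum_nonneg)
qed

section \<open>The smallest eigenvalue of a symmetric matrix\<close>

lemma det_nonzero_obtain_inverse:
  fixes H :: "real mat"
  assumes "H \<in> carrier_mat n n" "det H \<noteq> 0"
  obtains K where "K \<in> carrier_mat n n" "H * K = 1\<^sub>m n" "K * H = 1\<^sub>m n"
  using det_non_zero_imp_unit[OF assms, of "()"] unfolding Units_def by (auto simp: ring_mat_simps)

text \<open>The largest \<open>s\<close> for which \<open>G - s \<cdot> 1\<close> is positive semidefinite is an eigenvalue: were
  \<open>G - s \<cdot> 1\<close> invertible, Cauchy--Schwarz for its quadratic form would bound this form below by a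
  positive multiple of the squared length.\<close>
lemma symmetric_spectrum_lower_bound:
  fixes G :: "real mat"
  assumes G: "G \<in> carrier_mat n n" "G\<^sup>T = G" and n: "0 < n"
  obtains s where "s \<in> spectrum G" "\<And>x. x \<in> carrier_vec n \<Longrightarrow> s * (x \<bullet> x) \<le> x \<bullet> (G *\<^sub>v x)"
proof -
  define T where "T = {t. \<forall>x\<in>carrier_vec n. t * (x \<bullet> x) \<le> x \<bullet> (G *\<^sub>v x)}"
  define s where "s = Sup T"
  \<comment> \<open>\<open>T\<close> is nonempty and, tested at a unit vector (which exists because
    \<open>0 < n\<close>), bounded above, so its supremum is meaningful.\<close>
  have low: "- frobenius_norm G \<in> T"
    unfolding T_def
  proof (intro CollectI ballI)
    fix x :: "real vec" assume "x \<in> carrier_vec n"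
    from quadratic_form_le_frobenius[OF G(1) this]
    show "- frobenius_norm G * (x \<bullet> x) \<le> x \<bullet> (G *\<^sub>v x)" by (simp add: abs_le_iff)
  qed
  have bdd: "bdd_above T"
  proof (rule bdd_aboveI)
    fix t assume "t \<in> T"
    then have "t * (unit_vec n 0 \<bullet> unit_vec n 0) \<le> unit_vec n 0 \<bullet> (G *\<^sub>v unit_vec n 0)"
      by (simp add: T_def)
    then show "t \<le> unit_vec n 0 \<bullet> (G *\<^sub>v unit_vec n 0)"
      using n by simp
  qed
  \<comment> \<open>The supremum itself lies in \<open>T\<close>: for nonzero \<open>x\<close> every
    element of \<open>T\<close> is at most the Rayleigh quotient of \<open>x\<close>, hence so is
    \<open>s\<close>.\<close>
  have s: "s * (x \<bullet> x) \<le> x \<bullet> (G *\<^sub>v x)" if x: "x \<in> carrier_vec n" for x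
  proof (cases "x \<bullet> x = 0")
    case True
    then show ?thesis using low x by (force simp: T_def)
  next
    case False
    then have pos: "0 < x \<bullet> x" using scalar_prod_self_nonneg[of x] by simp
    have "s \<le> (x \<bullet> (G *\<^sub>v x)) / (x \<bullet> x)"
      unfolding s_def
    proof (rule cSup_least)
      show "T \<noteq> {}" using low by blast
      show "t \<le> (x \<bullet> (G *\<^sub>v x)) / (x \<bullet> x)" if "t \<in> T" for t
        using that x pos by (simp add: T_def field_simps)
    qed
    then show ?thesis using pos by (simp add: field_simps)
  qed
  define H where "H = G - s \<cdot>\<^sub>m 1\<^sub>m n"
  have H: "H \<in> carrier_mat n n" "H\<^sup>T = H"
  proof -
    show "H \<in> carrier_mat n n" by (simp add: H_def minus_carrier_mat)
    have "(s \<cdot>\<^sub>m 1\<^sub>m n)\<^sup>T = s \<cdot>\<^sub>m 1\<^sub>m n" by (rule eq_matI) auto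
    then show "H\<^sup>T = H" using G by (simp add: H_def transpose_minus[of _ n n])
  qed
  have Hx: "H *\<^sub>v x = G *\<^sub>v x - s \<cdot>\<^sub>v x" if x: "x \<in> carrier_vec n" for x
  proof -
    have "(s \<cdot>\<^sub>m 1\<^sub>m n) *\<^sub>v x = s \<cdot>\<^sub>v x"
      using x by (intro eq_vecI) auto
    then show ?thesis
      using G x by (simp add: H_def minus_mult_distrib_mat_vec[of _ n n])
  qed
  have xHx: "x \<bullet> (H *\<^sub>v x) = x \<bullet> (G *\<^sub>v x) - s * (x \<bullet> x)" if "x \<in> carrier_vec n" for x
    using G that by (simp add: Hx scalar_prod_minus_distrib[of _ n])
  have psd: "0 \<le> x \<bullet> (H *\<^sub>v x)" if "x \<in> carrier_vec n" for x
    using s[OF that] xHx[OF that] by simp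
  have "det H = 0"
  proof (rule ccontr)
    assume "det H \<noteq> 0"
    with H(1) obtain K where K: "K \<in> carrier_mat n n" "H * K = 1\<^sub>m n" "K * H = 1\<^sub>m n"
      by (rule det_nonzero_obtain_inverse)
    \<comment> \<open>The added 1 makes \<open>c\<close> positive whatever \<open>K\<close> is, and
      \<open>x \<bullet> (K *\<^sub>v x) \<le> c * (x \<bullet> x)\<close> still holds.\<close>
    define c where "c = frobenius_norm K + 1"
    have c: "0 < c" by (auto simp: c_def frobenius_norm_def intro!: add_nonneg_pos sum_nonneg)
    have "s + 1 / c \<in> T"
      unfolding T_def
    proof (intro CollectI ballI)
      fix x :: "real vec" assume x: "x \<in> carrier_vec n"
      have Kx: "K *\<^sub>v x \<in> carrier_vec n" using K x by auto
      have HK: "H *\<^sub>v (K *\<^sub>v x) = x"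
        using assoc_mult_mat_vec[OF H(1) K(1) x] K x by simp
      have comm: "(K *\<^sub>v x) \<bullet> x = x \<bullet> (K *\<^sub>v x)" using x Kx by (rule comm_scalar_prod[rotated])
      \<comment> \<open>Cauchy-Schwarz for \<open>H\<close> with \<open>y = K *\<^sub>v x\<close>:
        since \<open>H *\<^sub>v y = x\<close>, the mixed term is
        \<open>x \<bullet> x\<close>.\<close>
      have "(x \<bullet> x)\<^sup>2 \<le> (x \<bullet> (H *\<^sub>v x)) * (x \<bullet> (K *\<^sub>v x))"
        using psd_Cauchy_Schwarz[OF H psd x Kx] by (simp add: HK comm)
      also have "\<dots> \<le> (x \<bullet> (H *\<^sub>v x)) * (c * (x \<bullet> x))"
        using quadratic_form_le_frobenius[OF K(1) x] scalar_prod_self_nonneg[of x] psd[OF x]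
        by (intro mult_left_mono) (auto simp: c_def algebra_simps)
      finally have *: "(x \<bullet> x) * (x \<bullet> x) \<le> (c * (x \<bullet> (H *\<^sub>v x))) * (x \<bullet> x)"
        by (simp add: power2_eq_square algebra_simps)
      have "x \<bullet> x \<le> c * (x \<bullet> (H *\<^sub>v x))"
      proof (cases "x \<bullet> x = 0")
        case True
        then show ?thesis using psd[OF x] c by simp
      next
        case False
        with * scalar_prod_self_nonneg[of x] show ?thesis by (simp add: mult_le_cancel_right)
      qed
      with c have "(x \<bullet> x) / c \<le> x \<bullet> (H *\<^sub>v x)" by (simp add: field_simps)
      then show "(s + 1 / c) * (x \<bullet> x) \<le> x \<bullet> (G *\<^sub>v x)"
        using xHx[OF x] by (simp add: algebra_simps)
    qed
    then have "s + 1 / c \<le> s" unfolding s_def using bdd by (rule cSup_upper)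
    with c show False by (simp add: field_simps)
  qed
  \<comment> \<open>A kernel vector of \<open>H\<close> is an eigenvector of \<open>G\<close> for
    the value \<open>s\<close>.\<close>
  then obtain v where v: "v \<in> carrier_vec n" "v \<noteq> 0\<^sub>v n" "H *\<^sub>v v = 0\<^sub>v n"
    using det_0_iff_vec_prod_zero_field[OF H(1)] by auto
  have "G *\<^sub>v v = s \<cdot>\<^sub>v v"
  proof (rule eq_vecI)
    fix i assume i: "i < dim_vec (s \<cdot>\<^sub>v v)"
    have "G *\<^sub>v v - s \<cdot>\<^sub>v v = 0\<^sub>v n" using Hx[OF v(1)] v(3) by simp
    then have "(G *\<^sub>v v - s \<cdot>\<^sub>v v) $ i = 0" using v(1) i by (simp del: index_minus_vec)
    then show "(G *\<^sub>v v) $ i = (s \<cdot>\<^sub>v v) $ i" using G v i by simp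
  qed (use G v in auto)
  then have "s \<in> spectrum G"
    using G v by (auto simp: spectrum_def eigenvalue_def eigenvector_def)
  with s that show thesis by blast
qed

text \<open>The spectrum is finite, and the eigenvalue found above makes it nonempty, so
  \<open>Min\<close> is attained and not an unspecified value.\<close>

lemma lambda_min_in_spectrum:
  assumes "G \<in> carrier_mat n n" "G\<^sup>T = G" "0 < n"
  shows "lambda_min G \<in> spectrum G"
  using symmetric_spectrum_lower_bound[OF assms] card_finite_spectrum(1)[OF assms(1)]
  unfolding lambda_min_def by (metis Min_in empty_iff)

text \<open>The lower bound \<open>s\<close> found above is an eigenvalue, hence at least the
  smallest one.\<close>

lemma lambda_min_le_quadratic_form:
  assumes G: "G \<in> carrier_mat n n" "G\<^sup>T = G" and n: "0 < n" and x: "x \<in> carrier_vec n"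
  shows "lambda_min G * (x \<bullet> x) \<le> x \<bullet> (G *\<^sub>v x)"
proof -
  obtain s where s: "s \<in> spectrum G" "s * (x \<bullet> x) \<le> x \<bullet> (G *\<^sub>v x)"
    using symmetric_spectrum_lower_bound[OF G n] x by metis
  have "lambda_min G \<le> s"
    unfolding lambda_min_def by (rule Min_le[OF card_finite_spectrum(1)[OF G(1)] s(1)])
  then have "lambda_min G * (x \<bullet> x) \<le> s * (x \<bullet> x)"
    by (rule mult_right_mono[OF _ scalar_prod_self_nonneg])
  with s show ?thesis by simp
qed

section \<open>Gram matrices\<close>

lemma gram_quadratic_form:
  fixes W :: "real mat"
  assumes "W \<in> carrier_mat m n" "x \<in> carrier_vec n"
  shows "x \<bullet> (W\<^sup>T * W *\<^sub>v x) = (W *\<^sub>v x) \<bullet> (W *\<^sub>v x)"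
  using assms scalar_prod_transpose[of "W\<^sup>T" n m x "W *\<^sub>v x"]
  by (simp add: mult_mat_vec_assoc_dim)

lemma gram_symmetric: "((W :: real mat)\<^sup>T * W)\<^sup>T = W\<^sup>T * W"
  by (simp add: transpose_mult_dim)

text \<open>At an eigenvector \<open>v\<close>, the eigenvalue times \<open>v \<bullet> v\<close> is
  the squared length of \<open>W *\<^sub>v v\<close>.\<close>

lemma lambda_min_gram_nonneg:
  assumes W: "W \<in> carrier_mat m n" and n: "0 < n"
  shows "0 \<le> lambda_min (W\<^sup>T * W)"
proof -
  have G: "W\<^sup>T * W \<in> carrier_mat n n" using W by auto
  have "lambda_min (W\<^sup>T * W) \<in> spectrum (W\<^sup>T * W)"
    using G gram_symmetric n by (rule lambda_min_in_spectrum)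
  then obtain v where v: "v \<in> carrier_vec n" "v \<noteq> 0\<^sub>v n"
      "W\<^sup>T * W *\<^sub>v v = lambda_min (W\<^sup>T * W) \<cdot>\<^sub>v v"
    using G W by (auto simp: spectrum_def eigenvalue_def eigenvector_def)
  have "0 \<le> v \<bullet> (W\<^sup>T * W *\<^sub>v v)"
    unfolding gram_quadratic_form[OF W v(1)] by (rule scalar_prod_self_nonneg)
  also have "\<dots> = lambda_min (W\<^sup>T * W) * (v \<bullet> v)" using v by simp
  finally show ?thesis
    using v scalar_prod_self_nonneg[of v] scalar_prod_self_eq_0_iff[OF v(1)]
    by (auto simp: zero_le_mult_iff)
qed

text \<open>Testing the form at one unit vector suffices. The bound later gives \<alpha> \<le> 1 and
  thereby a nonnegative rate \<rho>.\<close>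

lemma lambda_min_gram_le_frobenius:
  assumes W: "W \<in> carrier_mat m n" and n: "0 < n"
  shows "lambda_min (W\<^sup>T * W) \<le> (frobenius_norm W)\<^sup>2"
proof -
  let ?e = "unit_vec n 0 :: real vec"
  have e: "?e \<in> carrier_vec n" by simp
  have "lambda_min (W\<^sup>T * W) * (?e \<bullet> ?e) \<le> ?e \<bullet> (W\<^sup>T * W *\<^sub>v ?e)"
    using W by (intro lambda_min_le_quadratic_form[OF _ gram_symmetric n]) auto
  also have "\<dots> \<le> (frobenius_norm W)\<^sup>2 * (?e \<bullet> ?e)"
    unfolding gram_quadratic_form[OF W e] by (rule mult_mat_vec_frobenius_le[OF W e])
  finally show ?thesis using n by simp
qed

text \<open>For \<open>v = W u\<close> one has \<open>\<lambda> \<bar>u\<bar>\<^sup>2 \<le> \<bar>v\<bar>\<^sup>2\<close> and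
  \<open>\<bar>v\<bar>\<^sup>2 = \<langle>u, W\<^sup>T v\<rangle> \<le> \<bar>u\<bar> \<bar>W\<^sup>T v\<bar>\<close>, so the smallest eigenvalue of \<open>W\<^sup>T W\<close>
  (not only that of \<open>W W\<^sup>T\<close>) works here.\<close>
lemma lambda_min_gram_le:
  assumes W: "W \<in> carrier_mat m n" and n: "0 < n"
    and v: "v \<in> carrier_vec m" and u: "u \<in> carrier_vec n" "W *\<^sub>v u = v"
  shows "lambda_min (W\<^sup>T * W) * (v \<bullet> v) \<le> (W\<^sup>T *\<^sub>v v) \<bullet> (W\<^sup>T *\<^sub>v v)"
proof (cases "v \<bullet> v = 0")
  case True
  then show ?thesis by (simp add: scalar_prod_self_nonneg)
next
  case False
  then have pos: "0 < v \<bullet> v" using scalar_prod_self_nonneg[of v] by simp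
  let ?l = "lambda_min (W\<^sup>T * W)" and ?z = "W\<^sup>T *\<^sub>v v"
  have z: "?z \<in> carrier_vec n" using W v by auto
  have "?l * (u \<bullet> u) \<le> u \<bullet> (W\<^sup>T * W *\<^sub>v u)"
    using W u by (intro lambda_min_le_quadratic_form[OF _ gram_symmetric n]) auto
  also have "\<dots> = v \<bullet> v" using gram_quadratic_form[OF W u(1)] u by simp
  finally have uv: "?l * (u \<bullet> u) \<le> v \<bullet> v" .
  have "v \<bullet> v = ?z \<bullet> u" using scalar_prod_transpose[OF W v u(1)] u by simp
  then have "(v \<bullet> v)\<^sup>2 \<le> (?z \<bullet> ?z) * (u \<bullet> u)"
    using scalar_prod_Cauchy_Schwarz[OF z u(1)] by simp
  then have "?l * (v \<bullet> v)\<^sup>2 \<le> ?l * ((?z \<bullet> ?z) * (u \<bullet> u))"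
    by (rule mult_left_mono[OF _ lambda_min_gram_nonneg[OF W n]])
  also have "\<dots> = (?z \<bullet> ?z) * (?l * (u \<bullet> u))" by simp
  also have "\<dots> \<le> (?z \<bullet> ?z) * (v \<bullet> v)"
    by (rule mult_left_mono[OF uv scalar_prod_self_nonneg])
  finally have "(?l * (v \<bullet> v)) * (v \<bullet> v) \<le> (?z \<bullet> ?z) * (v \<bullet> v)"
    by (simp add: power2_eq_square algebra_simps)
  with pos show ?thesis by simp
qed

text \<open>A maximal independent set of columns has as many elements as the rank, here
  \<open>a\<close>, so it is a basis and the columns span the whole space.\<close>

lemma full_row_rank_surj:
  assumes M: "M \<in> carrier_mat a b" and full: "full_row_rank M" and v: "v \<in> carrier_vec a"
  obtains u where "u \<in> carrier_vec b" "M *\<^sub>v u = v"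
proof -
  interpret vec_space "TYPE(real)" a .
  have cols: "set (cols M) \<subseteq> carrier_vec a" using M cols_dim by blast
  have "lin_indpt {}" by (auto simp: lin_dep_def)
  then obtain S where S: "maximal S (\<lambda>T. T \<subseteq> set (cols M) \<and> lin_indpt T)" "finite S"
    using maximal_exists_superset[of "set (cols M)" "\<lambda>T. T \<subseteq> set (cols M) \<and> lin_indpt T" "{}"]
    by auto
  then have S': "S \<subseteq> set (cols M)" "lin_indpt S" by (auto simp: maximal_def)
  have "card S = a"
    using rank_card_indpt[OF M S(1)] full M by (simp add: full_row_rank_def)
  then have "basis S"
    using S S' cols by (intro dim_li_is_basis) (auto simp: dim_is_n)
  then have "span S = carrier_vec a" by (simp add: basis_def)
  moreover have "span S \<subseteq> span (set (cols M))" using S' by (intro span_is_monotone)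
  ultimately have "v \<in> span_list (cols M)"
    using v span_list_as_span[OF cols] by blast
  then obtain c where "v = lincomb_list c (cols M)" by (auto simp: span_list_def)
  \<comment> \<open>The coefficients of the combination of columns are the entries of the
    preimage.\<close>
  also have "\<dots> = mat_of_cols a (cols M) *\<^sub>v vec (length (cols M)) c"
    using cols by (intro lincomb_list_as_mat_mult) auto
  finally have "M *\<^sub>v vec b c = v" using M by auto
  then show thesis by (intro that[of "vec b c"]) auto
qed

section \<open>Projections and sampling\<close>

text \<open>Surjectivity of the transpose gives \<open>u = W\<^sup>T *\<^sub>v v\<close>; then
  \<open>u \<bullet> u = v \<bullet> (W *\<^sub>v u) = 0\<close>.\<close>

lemma full_row_rank_transpose_inj:
  fixes W :: "real mat"
  assumes W: "W \<in> carrier_mat m t" and full: "full_row_rank (W\<^sup>T)"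
    and u: "u \<in> carrier_vec t" "W *\<^sub>v u = 0\<^sub>v m"
  shows "u = 0\<^sub>v t"
proof -
  obtain v where v: "v \<in> carrier_vec m" "W\<^sup>T *\<^sub>v v = u"
    using full_row_rank_surj[of "W\<^sup>T" t m u] W full u(1) by auto
  have "u \<bullet> u = v \<bullet> (W *\<^sub>v u)"
    using scalar_prod_transpose[OF W v(1) u(1)] v(2) by simp
  then have "u \<bullet> u = 0" using u v by simp
  then show ?thesis using u by (simp add: scalar_prod_self_eq_0_iff)
qed

text \<open>Independent columns make the Gram matrix invertible, since a kernel vector
  \<open>u\<close> would satisfy \<open>W *\<^sub>v u = 0\<^sub>v m\<close>. The pseudoinverse is
  then the ordinary inverse.\<close>

lemma gram_pinv:
  fixes W :: "real mat"
  assumes W: "W \<in> carrier_mat m t" and full: "full_row_rank (W\<^sup>T)"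
  shows "pinv (W\<^sup>T * W) \<in> carrier_mat t t"
    and "W\<^sup>T * W * pinv (W\<^sup>T * W) = 1\<^sub>m t"
    and "(pinv (W\<^sup>T * W))\<^sup>T = pinv (W\<^sup>T * W)"
proof -
  define G where "G = W\<^sup>T * W"
  have G: "G \<in> carrier_mat t t" "G\<^sup>T = G"
    using W gram_symmetric by (auto simp: G_def)
  have "det G \<noteq> 0"
  proof
    assume "det G = 0"
    then obtain u where u: "u \<in> carrier_vec t" "u \<noteq> 0\<^sub>v t" "G *\<^sub>v u = 0\<^sub>v t"
      using det_0_iff_vec_prod_zero_field[OF G(1)] by auto
    have "(W *\<^sub>v u) \<bullet> (W *\<^sub>v u) = 0"
      using gram_quadratic_form[OF W u(1)] u by (simp add: G_def)
    then have "W *\<^sub>v u = 0\<^sub>v m"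
      using W u by (subst (asm) scalar_prod_self_eq_0_iff[of _ m]) auto
    with full_row_rank_transpose_inj[OF W full u(1)] u(2) show False by simp
  qed
  with G(1) obtain K where K: "K \<in> carrier_mat t t" "G * K = 1\<^sub>m t" "K * G = 1\<^sub>m t"
    by (rule det_nonzero_obtain_inverse)
  have "penrose_inverse G K"
    using G K by (simp add: penrose_inverse_def)
  then have pinv: "pinv G = K"
    unfolding pinv_def using penrose_inverse_unique by (intro the_equality) auto
  \<comment> \<open>Transposing \<open>G * K = 1\<^sub>m t\<close> makes \<open>K\<^sup>T\<close> a
    left inverse of the symmetric \<open>G\<close>, hence equal to \<open>K\<close>.\<close>
  have "K\<^sup>T * G = 1\<^sub>m t"
    using transpose_mult[OF G(1) K(1)] G K by simp
  then have "K\<^sup>T = K"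
    using assoc_mult_mat[of "K\<^sup>T" t t G t K t] G K by simp
  with K pinv show "pinv (W\<^sup>T * W) \<in> carrier_mat t t" "W\<^sup>T * W * pinv (W\<^sup>T * W) = 1\<^sub>m t"
      "(pinv (W\<^sup>T * W))\<^sup>T = pinv (W\<^sup>T * W)"
    by (simp_all add: G_def)
qed

text \<open>For \<open>W\<close> with independent columns, the orthogonal projection onto the column
  space.\<close>

definition gram_projection :: "real mat \<Rightarrow> real mat" where
  "gram_projection W = W * pinv (W\<^sup>T * W) * W\<^sup>T"

lemma gram_projection:
  assumes W: "W \<in> carrier_mat m t" and full: "full_row_rank (W\<^sup>T)"
  shows "gram_projection W \<in> carrier_mat m m"
    and "(gram_projection W)\<^sup>T = gram_projection W"
    and "W\<^sup>T * gram_projection W = W\<^sup>T"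
    and "gram_projection W * gram_projection W = gram_projection W"
proof -
  define N where "N = pinv (W\<^sup>T * W)"
  have N: "N \<in> carrier_mat t t" "W\<^sup>T * W * N = 1\<^sub>m t" "N\<^sup>T = N"
    using gram_pinv[OF W full] by (simp_all add: N_def)
  have P: "gram_projection W = W * N * W\<^sup>T" by (simp add: gram_projection_def N_def)
  show "gram_projection W \<in> carrier_mat m m" using W N by (auto simp: P)
  show "(gram_projection W)\<^sup>T = gram_projection W"
    using W N by (simp add: P transpose_mult_dim mult_mat_assoc_dim)
  have "W\<^sup>T * gram_projection W = W\<^sup>T * W * N * W\<^sup>T"
    using W N(1) by (simp add: P mult_mat_assoc_dim)
  then show WP: "W\<^sup>T * gram_projection W = W\<^sup>T"
    using W N by simp
  \<comment> \<open>The second projection is absorbed by the trailing \<open>W\<^sup>T\<close> of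
    the first, by \<open>WP\<close>.\<close>
  have "gram_projection W * gram_projection W = W * N * (W\<^sup>T * gram_projection W)"
    using W N by (simp add: P mult_mat_assoc_dim)
  then show "gram_projection W * gram_projection W = gram_projection W"
    unfolding WP by (simp add: P)
qed

section \<open>Norm decrease under a two-sided projection\<close>

lemma frobenius_norm_diff_power2:
  assumes Y: "Y \<in> carrier_mat m n" and D: "D \<in> carrier_mat m n"
  shows "(frobenius_norm (Y - D))\<^sup>2
    = (frobenius_norm Y)\<^sup>2 + (frobenius_norm D)\<^sup>2 - 2 * mat_trace (Y\<^sup>T * D)"
proof -
  have "mat_trace (Y\<^sup>T * D) = (\<Sum>j<n. \<Sum>i<m. Y $$ (i, j) * D $$ (i, j))"
    using Y D by (auto simp: mat_trace_def scalar_prod_def atLeast0LessThan intro!: sum.cong)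
  also have "\<dots> = (\<Sum>i<m. \<Sum>j<n. Y $$ (i, j) * D $$ (i, j))"
    by (rule sum.swap)
  finally show ?thesis
    using Y D by (simp add: frobenius_norm_power2 power2_diff sum.distrib sum_subtractf
        sum_distrib_left mult.assoc)
qed

text \<open>Pythagoras: the inner product of \<open>Y\<close> with \<open>P * Y * Q\<close> equals
  the squared norm of \<open>P * Y * Q\<close>, by idempotence and cyclicity of the trace.\<close>

lemma frobenius_norm_two_sided_projection:
  assumes P: "P \<in> carrier_mat m m" "P\<^sup>T = P" "P * P = P"
    and Q: "Q \<in> carrier_mat n n" "Q\<^sup>T = Q" "Q * Q = Q"
    and Y: "Y \<in> carrier_mat m n"
  shows "(frobenius_norm (Y - P * Y * Q))\<^sup>2 = (frobenius_norm Y)\<^sup>2 - (frobenius_norm (P * Y * Q))\<^sup>2"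
proof -
  \<comment> \<open>\<open>E\<close> is chosen so that \<open>D\<^sup>T * D = Q * E\<close> and
    \<open>Y\<^sup>T * D = E * Q\<close>, which have the same trace.\<close>
  define D E where "D = P * Y * Q" and "E = Y\<^sup>T * P * Y * Q"
  have D: "D \<in> carrier_mat m n" and E: "E \<in> carrier_mat n n"
    using P Q Y by (auto simp: D_def E_def)
  \<comment> \<open>Idempotence in the right-nested form that reassociation produces.\<close>
  have PP: "P * (P * R) = P * R" if "dim_row R = m" for R
    using P that mult_mat_assoc_dim[of P P R] by simp
  have "D\<^sup>T * D = Q * E"
    using P Q Y by (simp add: D_def E_def transpose_mult_dim mult_mat_assoc_dim PP)
  then have "(frobenius_norm D)\<^sup>2 = mat_trace (Q * E)"
    by (simp flip: mat_trace_transpose_mult)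
  also have "\<dots> = mat_trace (E * Q)"
    using Q E by (intro mat_trace_mult_comm) auto
  also have "E * Q = Y\<^sup>T * D"
    using P Q Y by (simp add: D_def E_def mult_mat_assoc_dim)
  finally show ?thesis
    using frobenius_norm_diff_power2[OF Y D] by (simp add: D_def)
qed

text \<open>As a sum over the list of columns of \<open>S\<close>, the squared norm splits along
  concatenations of such lists.\<close>

lemma frobenius_norm_transpose_mult_cols:
  fixes S K :: "real mat"
  assumes "S \<in> carrier_mat d t" "K \<in> carrier_mat d l"
  shows "(frobenius_norm (S\<^sup>T * K))\<^sup>2
    = sum_list (map (\<lambda>c. \<Sum>j<l. (c \<bullet> col K j)\<^sup>2) (cols S))"
proof -
  have "(frobenius_norm (S\<^sup>T * K))\<^sup>2 = (\<Sum>i<t. \<Sum>j<l. (col S i \<bullet> col K j)\<^sup>2)"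
    using assms by (simp add: frobenius_norm_power2)
  then show ?thesis
    using assms by (simp add: sum_list_sum_nth atLeast0LessThan)
qed

lemma frobenius_norm_block_row:
  assumes S: "\<And>i. i < r \<Longrightarrow> S i \<in> carrier_mat d (t i)" and K: "K \<in> carrier_mat d l"
  shows "(frobenius_norm ((block_row d r S)\<^sup>T * K))\<^sup>2
    = (\<Sum>i<r. (frobenius_norm ((S i)\<^sup>T * K))\<^sup>2)"
proof -
  define g where "g = (\<lambda>c. \<Sum>j<l. (c \<bullet> col K j)\<^sup>2)"
  let ?cs = "concat (map (\<lambda>i. cols (S i)) [0..<r])"
  have B: "block_row d r S \<in> carrier_mat d (length ?cs)"
    unfolding block_row_def by (rule mat_of_cols_carrier)
  have "cols (block_row d r S) = ?cs"
    unfolding block_row_def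
  proof (rule cols_mat_of_cols)
    have "set (cols (S i)) \<subseteq> carrier_vec d" if "i < r" for i
      using S[OF that] cols_dim[of "S i"] by simp
    then show "set ?cs \<subseteq> carrier_vec d" by (simp add: UN_subset_iff)
  qed
  then have "(frobenius_norm ((block_row d r S)\<^sup>T * K))\<^sup>2 = sum_list (map g ?cs)"
    using frobenius_norm_transpose_mult_cols[OF B K] by (simp add: g_def)
  also have "sum_list (map g (concat (map (\<lambda>i. cols (S i)) xs)))
      = sum_list (map (\<lambda>i. sum_list (map g (cols (S i)))) xs)" for xs :: "nat list"
    by (induction xs) simp_all
  also have "sum_list (map (\<lambda>i. sum_list (map g (cols (S i)))) [0..<r])
      = (\<Sum>i<r. sum_list (map g (cols (S i))))"
    by (simp add: interv_sum_list_conv_sum_set_nat atLeast0LessThan)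
  also have "\<dots> = (\<Sum>i<r. (frobenius_norm ((S i)\<^sup>T * K))\<^sup>2)"
    using frobenius_norm_transpose_mult_cols[OF S K] by (intro sum.cong) (simp_all add: g_def)
  finally show ?thesis .
qed

text \<open>The first block has a column, so the Gram matrix built from the block row is nonempty,
  as \<open>lambda_min\<close> requires.\<close>

lemma block_row_carrier:
  assumes "0 < r" and "\<And>i. i < r \<Longrightarrow> 0 < t i \<and> S i \<in> carrier_mat d (t i)"
  obtains N where "0 < N" "block_row d r S \<in> carrier_mat d N"
proof (rule that)
  have "cols (S 0) \<noteq> []" using assms(1) assms(2)[of 0]
    by (metis carrier_matD(2) cols_length less_irrefl list.size(3))
  moreover have "cols (S 0) \<in> set (map (\<lambda>i. cols (S i)) [0..<r])"
    using assms(1) by auto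
  ultimately have "concat (map (\<lambda>i. cols (S i)) [0..<r]) \<noteq> []"
    by (metis concat_eq_Nil_conv)
  then show "0 < length (concat (map (\<lambda>i. cols (S i)) [0..<r]))"
    by (simp only: length_greater_0_conv not_False_eq_True)
qed (unfold block_row_def, rule mat_of_cols_carrier)

text \<open>\<open>lambda_min_gram_le\<close> is applied to each column of \<open>Z\<close>; full
  row rank supplies the required preimage.\<close>

lemma lambda_min_gram_frobenius_le:
  assumes W: "W \<in> carrier_mat m N" and N: "0 < N" and full: "full_row_rank W"
    and Z: "Z \<in> carrier_mat m l"
  shows "lambda_min (W\<^sup>T * W) * (frobenius_norm Z)\<^sup>2 \<le> (frobenius_norm (W\<^sup>T * Z))\<^sup>2"
proof -
  have "lambda_min (W\<^sup>T * W) * (frobenius_norm Z)\<^sup>2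
      = (\<Sum>j<l. lambda_min (W\<^sup>T * W) * (col Z j \<bullet> col Z j))"
    using Z by (simp add: frobenius_norm_power2_cols sum_distrib_left)
  also have "\<dots> \<le> (\<Sum>j<l. (W\<^sup>T *\<^sub>v col Z j) \<bullet> (W\<^sup>T *\<^sub>v col Z j))"
  proof (rule sum_mono)
    fix j assume "j \<in> {..<l}"
    have v: "col Z j \<in> carrier_vec m" using Z by auto
    obtain u where "u \<in> carrier_vec N" "W *\<^sub>v u = col Z j"
      using full_row_rank_surj[OF W full v] .
    then show "lambda_min (W\<^sup>T * W) * (col Z j \<bullet> col Z j)
        \<le> (W\<^sup>T *\<^sub>v col Z j) \<bullet> (W\<^sup>T *\<^sub>v col Z j)"
      by (rule lambda_min_gram_le[OF W N v])
  qed
  also have "\<dots> = (frobenius_norm (W\<^sup>T * Z))\<^sup>2"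
    unfolding frobenius_norm_power2_cols using W Z
    by (intro sum.cong) (simp_all only: carrier_matD index_mult_mat lessThan_iff
        col_mult2[of "W\<^sup>T" N m] transpose_carrier_mat)
  finally show ?thesis .
qed

text \<open>The width \<open>l\<close> is arbitrary so that the estimate fits \<open>Y\<close> as
  well as the transposed matrices arising on the right.\<close>

lemma average_projection_lower_bound:
  assumes A: "A \<in> carrier_mat p m" and r: "0 < r"
    and S: "\<And>i. i < r \<Longrightarrow> 0 < t i \<and> S i \<in> carrier_mat p (t i) \<and> full_row_rank ((S i)\<^sup>T * A)"
    and full: "full_row_rank (A\<^sup>T * block_row p r S)"
    and Z: "Z \<in> carrier_mat m l"
  defines "W \<equiv> A\<^sup>T * block_row p r S"
  shows "lambda_min (W\<^sup>T * W) / (frobenius_norm W)\<^sup>2 * (frobenius_norm Z)\<^sup>2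
    \<le> (\<Sum>i<r. (frobenius_norm (A\<^sup>T * S i))\<^sup>2 / (frobenius_norm W)\<^sup>2
          * (frobenius_norm (gram_projection (A\<^sup>T * S i) * Z))\<^sup>2)"
proof -
  obtain N where N: "0 < N" "block_row p r S \<in> carrier_mat p N"
    using block_row_carrier[of r t S p] r S by blast
  have W: "W \<in> carrier_mat m N" using A N by (auto simp: W_def)
  have "lambda_min (W\<^sup>T * W) * (frobenius_norm Z)\<^sup>2 \<le> (frobenius_norm (W\<^sup>T * Z))\<^sup>2"
    using lambda_min_gram_frobenius_le[OF W N(1) _ Z] full by (simp add: W_def)
  \<comment> \<open>Moving \<open>A\<close> to \<open>Z\<close> leaves the bare block row, whose
    contribution splits over the blocks.\<close>
  also have "W\<^sup>T * Z = (block_row p r S)\<^sup>T * (A * Z)"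
    using A N Z by (simp add: W_def transpose_mult_dim mult_mat_assoc_dim)
  also have "(frobenius_norm \<dots>)\<^sup>2 = (\<Sum>i<r. (frobenius_norm ((S i)\<^sup>T * (A * Z)))\<^sup>2)"
    using A Z S by (intro frobenius_norm_block_row[of r S p t _ l]) auto
  also have "\<dots> \<le> (\<Sum>i<r. (frobenius_norm (A\<^sup>T * S i))\<^sup>2
      * (frobenius_norm (gram_projection (A\<^sup>T * S i) * Z))\<^sup>2)"
  proof (rule sum_mono)
    fix i assume "i \<in> {..<r}"
    with S have Si: "S i \<in> carrier_mat p (t i)" "full_row_rank ((S i)\<^sup>T * A)" by auto
    define V where "V = A\<^sup>T * S i"
    have V: "V \<in> carrier_mat m (t i)" "V\<^sup>T = (S i)\<^sup>T * A"
      using A Si by (auto simp: V_def transpose_mult_dim)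
    note P = gram_projection[OF V(1), unfolded V(2), OF Si(2), folded V(2)]
    \<comment> \<open>The projection can be inserted because
      \<open>V\<^sup>T * gram_projection V = V\<^sup>T\<close>.\<close>
    have "(S i)\<^sup>T * (A * Z) = V\<^sup>T * gram_projection V * Z"
      using A Si Z V P(3) by (simp add: mult_mat_assoc_dim)
    also have "\<dots> = V\<^sup>T * (gram_projection V * Z)"
      using V(1) Z P(1) by (simp add: mult_mat_assoc_dim)
    finally have "(frobenius_norm ((S i)\<^sup>T * (A * Z)))\<^sup>2
        \<le> (frobenius_norm (V\<^sup>T))\<^sup>2 * (frobenius_norm (gram_projection V * Z))\<^sup>2"
      using frobenius_norm_mult_le[of "V\<^sup>T" "t i" m "gram_projection V * Z" l] V(1) Z P(1) by simp
    then show "(frobenius_norm ((S i)\<^sup>T * (A * Z)))\<^sup>2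
        \<le> (frobenius_norm (A\<^sup>T * S i))\<^sup>2 * (frobenius_norm (gram_projection (A\<^sup>T * S i) * Z))\<^sup>2"
      by (simp add: V_def)
  qed
  finally show ?thesis
    by (simp add: divide_right_mono flip: sum_divide_distrib)
qed

text \<open>Stated for the left factor; the right factor is the instance with
  \<open>B\<^sup>T\<close> in place of \<open>A\<close>.\<close>

lemma sampled_projections:
  assumes A: "A \<in> carrier_mat p m"
    and S: "\<And>i. i < r \<Longrightarrow> 0 < t i \<and> S i \<in> carrier_mat p (t i) \<and> full_row_rank ((S i)\<^sup>T * A) \<and> 0 < w i"
    and full: "full_row_rank (A\<^sup>T * block_row p r S)"
    and w: "(\<Sum>i<r. w i) = 1"
      "\<And>i. i < r \<Longrightarrow> w i = mat_trace ((S i)\<^sup>T * A * A\<^sup>T * S i) / (frobenius_norm (A\<^sup>T * block_row p r S))\<^sup>2"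
  defines "\<alpha> \<equiv> lambda_min ((block_row p r S)\<^sup>T * A * A\<^sup>T * block_row p r S)
      / (frobenius_norm (A\<^sup>T * block_row p r S))\<^sup>2"
  shows "0 \<le> \<alpha>" "\<alpha> \<le> 1"
    and "\<And>Z l. Z \<in> carrier_mat m l \<Longrightarrow> \<alpha> * (frobenius_norm Z)\<^sup>2
      \<le> (\<Sum>i<r. w i * (frobenius_norm (gram_projection (A\<^sup>T * S i) * Z))\<^sup>2)"
proof -
  have r: "0 < r" using w(1) by (cases "r = 0") auto
  obtain N where N: "0 < N" "block_row p r S \<in> carrier_mat p N"
    using block_row_carrier[of r t S p] r S by blast
  define W where "W = A\<^sup>T * block_row p r S"
  have W: "W \<in> carrier_mat m N" using A N by (auto simp: W_def)
  have WW: "(block_row p r S)\<^sup>T * A * A\<^sup>T * block_row p r S = W\<^sup>T * W"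
    using A N by (simp add: W_def transpose_mult_dim mult_mat_assoc_dim)
  have w_frob: "w i = (frobenius_norm (A\<^sup>T * S i))\<^sup>2 / (frobenius_norm W)\<^sup>2" if "i < r" for i
  proof -
    have "S i \<in> carrier_mat p (t i)" using S[OF that] by blast
    with A have "(S i)\<^sup>T * A * A\<^sup>T * S i = (A\<^sup>T * S i)\<^sup>T * (A\<^sup>T * S i)"
      by (simp add: transpose_mult_dim mult_mat_assoc_dim)
    with w(2)[OF that] show ?thesis by (simp add: mat_trace_transpose_mult W_def)
  qed
  \<comment> \<open>If the norm were 0, division by zero would give \<open>w 0 = 0\<close>, against
    \<open>0 < w 0\<close>.\<close>
  have pos: "0 < (frobenius_norm W)\<^sup>2"
    using w_frob[OF r] S[OF r] by (cases "frobenius_norm W = 0") auto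
  have \<alpha>: "\<alpha> = lambda_min (W\<^sup>T * W) / (frobenius_norm W)\<^sup>2"
    by (simp add: \<alpha>_def WW flip: W_def)
  show "0 \<le> \<alpha>" unfolding \<alpha> using lambda_min_gram_nonneg[OF W N(1)] by simp
  show "\<alpha> \<le> 1" unfolding \<alpha> using lambda_min_gram_le_frobenius[OF W N(1)] pos by simp
  show "\<alpha> * (frobenius_norm Z)\<^sup>2
      \<le> (\<Sum>i<r. w i * (frobenius_norm (gram_projection (A\<^sup>T * S i) * Z))\<^sup>2)"
    if "Z \<in> carrier_mat m l" for Z l
    using average_projection_lower_bound[OF A r _ full that, of t] S w_frob
    by (simp add: \<alpha> flip: W_def)
qed

text \<open>With \<open>C = A * Xs * B\<close> the residual is \<open>A * (X - Xs) * B\<close>, and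
  regrouping the products gathers a projection on each side.\<close>

lemma sampling_step_error:
  assumes A: "A \<in> carrier_mat p m" and B: "B \<in> carrier_mat n q"
    and S: "S \<in> carrier_mat p s" "full_row_rank (S\<^sup>T * A)"
    and P: "P \<in> carrier_mat q t" "full_row_rank (P\<^sup>T * B\<^sup>T)"
    and X: "X \<in> carrier_mat m n" and Xs: "Xs \<in> carrier_mat m n"
  shows "sampling_step A B (A * Xs * B) S P X - Xs
    = (X - Xs) - gram_projection (A\<^sup>T * S) * (X - Xs) * gram_projection (B * P)"
proof -
  define V U where "V = A\<^sup>T * S" and "U = B * P"
  have V: "V \<in> carrier_mat m s" "V\<^sup>T = S\<^sup>T * A" and U: "U \<in> carrier_mat n t" "U\<^sup>T = P\<^sup>T * B\<^sup>T"
    using A S B P by (auto simp: V_def U_def transpose_mult_dim)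
  define N K where "N = pinv (V\<^sup>T * V)" and "K = pinv (U\<^sup>T * U)"
  have N: "N \<in> carrier_mat s s" and K: "K \<in> carrier_mat t t"
    using gram_pinv(1)[OF V(1)] gram_pinv(1)[OF U(1)] S P U V by (auto simp: N_def K_def)
  have N': "pinv (S\<^sup>T * A * A\<^sup>T * S) = N" and K': "pinv (P\<^sup>T * B\<^sup>T * B * P) = K"
    using A B S P by (simp_all add: N_def K_def V_def U_def transpose_mult_dim mult_mat_assoc_dim)
  define D where "D = gram_projection V * (X - Xs) * gram_projection U"
  have "D = A\<^sup>T * S * N * (S\<^sup>T * A) * (X - Xs) * (B * P * K * (P\<^sup>T * B\<^sup>T))"
  proof -
    have "gram_projection V = V * N * V\<^sup>T" "gram_projection U = U * K * U\<^sup>T"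
      by (simp_all only: gram_projection_def N_def K_def)
    then show ?thesis unfolding D_def U(2) V(2) by (simp only: V_def U_def)
  qed
  also have "\<dots> = A\<^sup>T * S * N * S\<^sup>T * (A * (X - Xs) * B) * P * K * P\<^sup>T * B\<^sup>T"
    using A B S P X Xs N K by (simp add: mult_mat_assoc_dim)
  also have "A * (X - Xs) * B = A * X * B - A * Xs * B"
    using A B X Xs by (simp add: mult_minus_distrib_mat[of _ p m] minus_mult_distrib_mat[of _ p n])
  finally have step: "sampling_step A B (A * Xs * B) S P X = X - D"
    unfolding sampling_step_def N' K' by simp
  have D: "D \<in> carrier_mat m n"
    using U(1) V(1) N K X Xs unfolding D_def gram_projection_def N_def[symmetric] K_def[symmetric]
    by (auto intro!: mult_carrier_mat minus_carrier_mat)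
  have "X - D - Xs = X - Xs - D"
    using X Xs D by (intro eq_matI) auto
  then show ?thesis by (simp add: step D_def V_def U_def)
qed

section \<open>Random iterations driven by independent indices\<close>

lemma map_pair_upt_eq_iff:
  "map (\<lambda>t. (f t, g t)) [0..<k] = l
    \<longleftrightarrow> length l = k \<and> (\<forall>t<k. f t = fst (l ! t) \<and> g t = snd (l ! t))"
  by (simp add: list_eq_iff_nth_eq prod_eq_iff) metis

text \<open>The averaging over index paths, free of any probability space. Induction peels off the
  first step, so the start must vary: the hypothesis is used at \<open>st x e\<close>, the
  contraction at \<open>x\<close>.\<close>

lemma weighted_paths_contraction:
  fixes V :: "'s \<Rightarrow> real" and st :: "'s \<Rightarrow> 'e \<Rightarrow> 's"
  assumes E: "finite E" and w: "\<And>e. e \<in> E \<Longrightarrow> 0 \<le> w e" and \<rho>: "0 \<le> \<rho>"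
    and D: "\<And>x e. x \<in> D \<Longrightarrow> e \<in> E \<Longrightarrow> st x e \<in> D"
    and contr: "\<And>x. x \<in> D \<Longrightarrow> (\<Sum>e\<in>E. w e * V (st x e)) \<le> \<rho> * V x"
  shows "x \<in> D \<Longrightarrow> (\<Sum>l | set l \<subseteq> E \<and> length l = k. prod_list (map w l) * V (foldl st x l))
    \<le> \<rho> ^ k * V x"
proof (induction k arbitrary: x)
  case 0
  have "{l. set l \<subseteq> E \<and> length l = 0} = {[]}" by auto
  then show ?case by simp
next
  case (Suc k)
  let ?G = "{l. set l \<subseteq> E \<and> length l = k}"
  have G: "{l. set l \<subseteq> E \<and> length l = Suc k} = (\<lambda>(e, l). e # l) ` (E \<times> ?G)"
    by (auto simp: length_Suc_conv image_iff)
  have inj: "inj_on (\<lambda>(e, l). e # l) (E \<times> ?G)" by (auto simp: inj_on_def)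
  have "(\<Sum>l | set l \<subseteq> E \<and> length l = Suc k. prod_list (map w l) * V (foldl st x l))
      = (\<Sum>(e, l)\<in>E \<times> ?G. w e * (prod_list (map w l) * V (foldl st (st x e) l)))"
    unfolding G by (subst sum.reindex[OF inj]) (simp add: case_prod_unfold mult.assoc)
  also have "\<dots> = (\<Sum>e\<in>E. w e * (\<Sum>l\<in>?G. prod_list (map w l) * V (foldl st (st x e) l)))"
    by (simp add: sum.cartesian_product[symmetric] sum_distrib_left)
  also have "\<dots> \<le> (\<Sum>e\<in>E. w e * (\<rho> ^ k * V (st x e)))"
    using Suc.IH D Suc.prems w by (intro sum_mono mult_left_mono) auto
  also have "\<dots> = \<rho> ^ k * (\<Sum>e\<in>E. w e * V (st x e))"
    by (simp add: sum_distrib_left mult.left_commute)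
  also have "\<dots> \<le> \<rho> ^ k * (\<rho> * V x)"
    using contr[OF Suc.prems] \<rho> by (intro mult_left_mono) auto
  finally show ?case by (simp add: mult_ac)
qed

text \<open>\<open>case_sum I J\<close> merges both sequences into one family over
  \<open>nat + nat\<close>, so its independence covers draws within each sequence and between the
  two. The path event is an intersection of single-index events of this family.\<close>

lemma (in prob_space) prob_index_path:
  fixes I J :: "nat \<Rightarrow> 'a \<Rightarrow> nat" and p1 p2 :: "nat \<Rightarrow> real"
  assumes indep: "indep_vars (\<lambda>_. count_space UNIV) (case_sum I J) (UNIV :: (nat + nat) set)"
    and I: "\<And>t i. i < r1 \<Longrightarrow> prob {\<omega> \<in> space M. I t \<omega> = i} = p1 i"
    and J: "\<And>t j. j < r2 \<Longrightarrow> prob {\<omega> \<in> space M. J t \<omega> = j} = p2 j"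
    and l: "set l \<subseteq> {..<r1} \<times> {..<r2}"
  shows "prob {\<omega> \<in> space M. map (\<lambda>t. (I t \<omega>, J t \<omega>)) [0..<length l] = l}
    = prod_list (map (\<lambda>(i, j). p1 i * p2 j) l)"
\<comment> \<open>The empty path is separate: an intersection over no indices would not be
  \<open>space M\<close>.\<close>
proof (cases "l = []")
  case True
  then show ?thesis by (simp add: prob_space)
next
  case False
  define k where "k = length l"
  \<comment> \<open>\<open>c\<close> prescribes for each member of the merged family the single
    value that \<open>l\<close> demands.\<close>
  define c where "c = case_sum (\<lambda>t. {fst (l ! t)}) (\<lambda>t. {snd (l ! t)})"
  let ?K = "Inl ` {..<k} \<union> Inr ` {..<k} :: (nat + nat) set"
  have k: "0 < k" using False by (simp add: k_def)
  have lt: "fst (l ! t) < r1" "snd (l ! t) < r2" if "t < k" for t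
    using subsetD[OF l nth_mem, of t] that by (auto simp: k_def)
  have "{\<omega> \<in> space M. map (\<lambda>t. (I t \<omega>, J t \<omega>)) [0..<length l] = l}
      = (\<Inter>s\<in>?K. case_sum I J s -` c s \<inter> space M)"
    using k unfolding map_pair_upt_eq_iff k_def[symmetric] by (auto simp: c_def ball_Un)
  also have "prob \<dots> = (\<Prod>s\<in>?K. prob (case_sum I J s -` c s \<inter> space M))"
    using k by (intro indep_varsD[OF indep]) auto
  also have "\<dots> = (\<Prod>s\<in>Inl ` {..<k}. prob (case_sum I J s -` c s \<inter> space M))
      * (\<Prod>s\<in>Inr ` {..<k}. prob (case_sum I J s -` c s \<inter> space M))"
    by (intro prod.union_disjoint) auto
  also have "(\<Prod>s\<in>Inl ` {..<k}. prob (case_sum I J s -` c s \<inter> space M)) = (\<Prod>t<k. p1 (fst (l ! t)))"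
  proof (subst prod.reindex)
    show "prod ((\<lambda>s. prob (case_sum I J s -` c s \<inter> space M)) \<circ> Inl) {..<k} = (\<Prod>t<k. p1 (fst (l ! t)))"
      using I[OF lt(1)]
      by (intro prod.cong) (auto simp: c_def vimage_def Int_def conj_commute)
  qed auto
  also have "(\<Prod>s\<in>Inr ` {..<k}. prob (case_sum I J s -` c s \<inter> space M)) = (\<Prod>t<k. p2 (snd (l ! t)))"
  proof (subst prod.reindex)
    show "prod ((\<lambda>s. prob (case_sum I J s -` c s \<inter> space M)) \<circ> Inr) {..<k} = (\<Prod>t<k. p2 (snd (l ! t)))"
      using J[OF lt(2)]
      by (intro prod.cong) (auto simp: c_def vimage_def Int_def conj_commute)
  qed auto
  also have "(\<Prod>t<k. p1 (fst (l ! t))) * (\<Prod>t<k. p2 (snd (l ! t)))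
      = (\<Prod>t<k. (\<lambda>(i, j). p1 i * p2 j) (l ! t))"
    by (simp add: prod.distrib case_prod_unfold)
  also have "\<dots> = prod_list (map (\<lambda>(i, j). p1 i * p2 j) l)"
    by (simp add: prod.list_conv_set_nth k_def atLeast0LessThan)
  finally show ?thesis .
qed

lemma (in prob_space) AE_index_less:
  fixes I :: "'a \<Rightarrow> nat" and p :: "nat \<Rightarrow> real"
  assumes [measurable]: "I \<in> measurable M (count_space UNIV)"
    and I: "\<And>i. i < r \<Longrightarrow> prob {\<omega> \<in> space M. I \<omega> = i} = p i"
    and p: "(\<Sum>i<r. p i) = 1"
  shows "AE \<omega> in M. I \<omega> < r"
proof (subst prob_Collect_eq_1[symmetric])
  have "prob (\<Union>i<r. {\<omega> \<in> space M. I \<omega> = i}) = (\<Sum>i<r. prob {\<omega> \<in> space M. I \<omega> = i})"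
    by (intro finite_measure_finite_Union) (auto simp: disjoint_family_on_def)
  also have "(\<Union>i<r. {\<omega> \<in> space M. I \<omega> = i}) = {\<omega> \<in> space M. I \<omega> < r}" by auto
  finally show "prob {\<omega> \<in> space M. I \<omega> < r} = 1" using I p by simp
qed measurable

text \<open>\<open>X k\<close> depends on \<omega> only through the first \<open>k\<close> index
  pairs, which almost surely form one of finitely many paths; the expectation is therefore a finite
  weighted sum.\<close>

lemma (in prob_space) expectation_random_iteration_le:
  fixes I J :: "nat \<Rightarrow> 'a \<Rightarrow> nat" and p1 p2 :: "nat \<Rightarrow> real" and V :: "'s \<Rightarrow> real"
    and step :: "nat \<Rightarrow> nat \<Rightarrow> 's \<Rightarrow> 's"
  assumes indep: "indep_vars (\<lambda>_. count_space UNIV) (case_sum I J) (UNIV :: (nat + nat) set)"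
    and I: "\<And>t i. i < r1 \<Longrightarrow> prob {\<omega> \<in> space M. I t \<omega> = i} = p1 i"
    and J: "\<And>t j. j < r2 \<Longrightarrow> prob {\<omega> \<in> space M. J t \<omega> = j} = p2 j"
    and p: "(\<Sum>i<r1. p1 i) = 1" "(\<Sum>j<r2. p2 j) = 1"
    and X_0: "\<And>\<omega>. \<omega> \<in> space M \<Longrightarrow> X 0 \<omega> = x0"
    and X_Suc: "\<And>t \<omega>. \<omega> \<in> space M \<Longrightarrow> X (Suc t) \<omega> = step (I t \<omega>) (J t \<omega>) (X t \<omega>)"
    and \<rho>: "0 \<le> \<rho>" and x0: "x0 \<in> D"
    and D: "\<And>x i j. x \<in> D \<Longrightarrow> i < r1 \<Longrightarrow> j < r2 \<Longrightarrow> step i j x \<in> D"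
    and contr: "\<And>x. x \<in> D \<Longrightarrow> (\<Sum>i<r1. \<Sum>j<r2. p1 i * p2 j * V (step i j x)) \<le> \<rho> * V x"
  shows "expectation (\<lambda>\<omega>. V (X k \<omega>)) \<le> \<rho> ^ k * V x0"
proof -
  define st where "st x = (\<lambda>(i, j). step i j x)" for x
  define w where "w = (\<lambda>(i, j). p1 i * p2 j)"
  define E where "E = {..<r1} \<times> {..<r2}"
  define L where "L k \<omega> = map (\<lambda>t. (I t \<omega>, J t \<omega>)) [0..<k]" for k \<omega>
  define G where "G = {l. set l \<subseteq> E \<and> length l = k}"
  define h where "h l = V (foldl st x0 l)" for l
  have E: "finite E" by (simp add: E_def)
  have G: "finite G" unfolding G_def by (rule finite_lists_length_eq[OF E])
  have rv: "case_sum I J s \<in> measurable M (count_space UNIV)" for s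
    using indep by (simp add: indep_vars_def)
  have IJ [measurable]: "I t \<in> measurable M (count_space UNIV)" "J t \<in> measurable M (count_space UNIV)" for t
    using rv[of "Inl t"] rv[of "Inr t"] by simp_all
  have X: "X t \<omega> = foldl st x0 (L t \<omega>)" if "\<omega> \<in> space M" for t \<omega>
    by (induction t) (simp_all add: L_def X_0 X_Suc that st_def)
  \<comment> \<open>The paths form a countable type, so it suffices to measure each fibre, a finite
    conjunction of conditions on single indices.\<close>
  have L [measurable]: "L k \<in> measurable M (count_space UNIV)"
  proof (subst measurable_count_space_eq2_countable)
    have "L k -` {l} \<inter> space M
        = {\<omega> \<in> space M. length l = k \<and> (\<forall>t<k. I t \<omega> = fst (l ! t) \<and> J t \<omega> = snd (l ! t))}" for l
      unfolding L_def vimage_def map_pair_upt_eq_iff[symmetric] by blast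
    then show "L k \<in> space M \<rightarrow> UNIV \<and> (\<forall>l\<in>UNIV. L k -` {l} \<inter> space M \<in> sets M)"
      by auto
  qed
  \<comment> \<open>Indices out of range are excluded only up to a null set.\<close>
  have "AE \<omega> in M. \<forall>t\<in>{..<k}. I t \<omega> < r1 \<and> J t \<omega> < r2"
    using AE_index_less[OF IJ(1) I p(1)] AE_index_less[OF IJ(2) J p(2)]
    by (intro AE_finite_allI) auto
  then have LG: "AE \<omega> in M. L k \<omega> \<in> G"
    by eventually_elim (auto simp: L_def G_def E_def)
  have "expectation (\<lambda>\<omega>. V (X k \<omega>)) = expectation (\<lambda>\<omega>. h (L k \<omega>))"
    by (intro Bochner_Integration.integral_cong) (simp_all add: X h_def)
  \<comment> \<open>For a path in \<open>G\<close> exactly one indicator is nonzero, so the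
    integrand agrees almost everywhere with an integrable simple function.\<close>
  also have "\<dots> = expectation (\<lambda>\<omega>. \<Sum>l\<in>G. h l * indicator {\<omega> \<in> space M. L k \<omega> = l} \<omega>)"
  proof (rule integral_cong_AE)
    show "AE \<omega> in M. h (L k \<omega>) = (\<Sum>l\<in>G. h l * indicator {\<omega> \<in> space M. L k \<omega> = l} \<omega>)"
      using LG AE_space
    proof eventually_elim
      case (elim \<omega>)
      have "(\<Sum>l\<in>G. h l * indicator {\<omega> \<in> space M. L k \<omega> = l} \<omega>) = (\<Sum>l\<in>G. if L k \<omega> = l then h l else 0)"
        using elim(2) by (intro sum.cong) (auto simp: indicator_def)
      then show ?case using elim(1) G by simp
    qed
  qed measurable
  also have "\<dots> = (\<Sum>l\<in>G. h l * prob {\<omega> \<in> space M. L k \<omega> = l})"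
    by (subst Bochner_Integration.integral_sum)
      (auto intro!: integrable_mult_right integrable_real_indicator simp: emeasure_eq_measure)
  also have "\<dots> = (\<Sum>l\<in>G. prod_list (map w l) * h l)"
    using prob_index_path[OF indep I J]
    by (intro sum.cong) (auto simp: G_def E_def w_def L_def)
  also have "\<dots> \<le> \<rho> ^ k * V x0"
    unfolding G_def h_def
  proof (rule weighted_paths_contraction[OF E _ \<rho> _ _ x0])
    have p_nonneg: "0 \<le> p1 i" "0 \<le> p2 j" if "i < r1" "j < r2" for i j
      using I[of i 0] J[of j 0] that by (metis measure_nonneg)+
    show "0 \<le> w e" if "e \<in> E" for e
      using that p_nonneg by (auto simp: w_def E_def)
    show "st x e \<in> D" if "x \<in> D" "e \<in> E" for x e
      using that D by (auto simp: st_def E_def)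
    show "(\<Sum>e\<in>E. w e * V (st x e)) \<le> \<rho> * V x" if "x \<in> D" for x
      using contr[OF that] by (simp add: E_def w_def st_def sum.cartesian_product case_prod_unfold)
  qed
  finally show ?thesis .
qed

section \<open>Convergence in mean square\<close>

theorem theorem4p7:
  fixes A B C Xstar X0 :: "real mat"
    and p q m n r1 r2 k :: nat
    and \<tau>1 \<tau>2 :: "nat \<Rightarrow> nat"
    and Ss Ps :: "nat \<Rightarrow> real mat"
    and p1 p2 :: "nat \<Rightarrow> real"
    and M :: "'w measure"
    and I J :: "nat \<Rightarrow> 'w \<Rightarrow> nat"
    and X :: "nat \<Rightarrow> 'w \<Rightarrow> real mat"
    and \<rho> :: real
  defines "SS \<equiv> block_row p r1 Ss"
    and "PP \<equiv> block_row q r2 Ps"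
  assumes A: "A \<in> carrier_mat p m" and B: "B \<in> carrier_mat n q" and C: "C \<in> carrier_mat p q"
    and Xstar: "Xstar \<in> carrier_mat m n" "A * Xstar * B = C"
    and sampling: "complete_discrete_sampling A B r1 \<tau>1 Ss p1 r2 \<tau>2 Ps p2"
    and p1: "\<And>i. i < r1 \<Longrightarrow>
      p1 i = mat_trace ((Ss i)\<^sup>T * A * A\<^sup>T * Ss i) / (frobenius_norm (A\<^sup>T * SS))\<^sup>2"
    and p2: "\<And>j. j < r2 \<Longrightarrow>
      p2 j = mat_trace ((Ps j)\<^sup>T * B\<^sup>T * B * Ps j) / (frobenius_norm (B * PP))\<^sup>2"
    and M: "prob_space M"
    and indep: "prob_space.indep_vars M (\<lambda>_. count_space UNIV) (case_sum I J) (UNIV :: (nat + nat) set)"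
    and I: "\<And>t i. i < r1 \<Longrightarrow> measure M {\<omega> \<in> space M. I t \<omega> = i} = p1 i"
    and J: "\<And>t j. j < r2 \<Longrightarrow> measure M {\<omega> \<in> space M. J t \<omega> = j} = p2 j"
    and X0: "X0 \<in> carrier_mat m n"
    and X_0: "\<And>\<omega>. \<omega> \<in> space M \<Longrightarrow> X 0 \<omega> = X0"
    and X_Suc: "\<And>t \<omega>. \<omega> \<in> space M \<Longrightarrow>
      X (Suc t) \<omega> = sampling_step A B C (Ss (I t \<omega>)) (Ps (J t \<omega>)) (X t \<omega>)"
    and \<rho>: "\<rho> = 1 - lambda_min (SS\<^sup>T * A * A\<^sup>T * SS) * lambda_min (PP\<^sup>T * B\<^sup>T * B * PP)
                    / ((frobenius_norm (A\<^sup>T * SS))\<^sup>2 * (frobenius_norm (B * PP))\<^sup>2)"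
  shows "prob_space.expectation M (\<lambda>\<omega>. (frobenius_norm (X k \<omega> - Xstar))\<^sup>2)
           \<le> \<rho> ^ k * (frobenius_norm (X0 - Xstar))\<^sup>2"
proof -
  interpret prob_space M by (rule M)
  have dims: "dim_row A = p" "dim_col B = q" using A B by auto
  note sampl = sampling[unfolded complete_discrete_sampling_def dims, folded SS_def PP_def]
  have S: "0 < \<tau>1 i \<and> Ss i \<in> carrier_mat p (\<tau>1 i) \<and> full_row_rank ((Ss i)\<^sup>T * A) \<and> 0 < p1 i"
    if "i < r1" for i using sampl that by blast
  have P: "0 < \<tau>2 j \<and> Ps j \<in> carrier_mat q (\<tau>2 j) \<and> full_row_rank ((Ps j)\<^sup>T * B\<^sup>T) \<and> 0 < p2 j"
    if "j < r2" for j using sampl that by blast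
  have sum1: "(\<Sum>i<r1. p1 i) = 1" and sum2: "(\<Sum>j<r2. p2 j) = 1"
    and full1: "full_row_rank (A\<^sup>T * SS)" and full2: "full_row_rank (B * PP)"
    using sampl by blast+
  \<comment> \<open>\<alpha> and \<beta> are the gains of the two sides; the rate is
    \<open>1 - \<alpha> * \<beta>\<close>.\<close>
  define \<alpha> where "\<alpha> = lambda_min (SS\<^sup>T * A * A\<^sup>T * SS) / (frobenius_norm (A\<^sup>T * SS))\<^sup>2"
  define \<beta> where "\<beta> = lambda_min (PP\<^sup>T * B\<^sup>T * B * PP) / (frobenius_norm (B * PP))\<^sup>2"
  define \<Phi> where "\<Phi> i = gram_projection (A\<^sup>T * Ss i)" for i
  define \<Psi> where "\<Psi> j = gram_projection (B * Ps j)" for j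
  have left: "0 \<le> \<alpha>" "\<alpha> \<le> 1"
    and left_le: "\<And>Z l. Z \<in> carrier_mat m l \<Longrightarrow> \<alpha> * (frobenius_norm Z)\<^sup>2
      \<le> (\<Sum>i<r1. p1 i * (frobenius_norm (\<Phi> i * Z))\<^sup>2)"
    using sampled_projections[OF A S full1[unfolded SS_def] sum1 p1[unfolded SS_def],
      folded SS_def, folded \<alpha>_def \<Phi>_def] by blast+
  have B': "B\<^sup>T \<in> carrier_mat q n" using B by auto
  have right: "0 \<le> \<beta>" "\<beta> \<le> 1"
    and right_le: "\<And>Z l. Z \<in> carrier_mat n l \<Longrightarrow> \<beta> * (frobenius_norm Z)\<^sup>2
      \<le> (\<Sum>j<r2. p2 j * (frobenius_norm (\<Psi> j * Z))\<^sup>2)"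
    using sampled_projections[of "B\<^sup>T" q n r2 \<tau>2 Ps p2, unfolded Matrix.transpose_transpose,
      OF B' P full2[unfolded PP_def] sum2 p2[unfolded PP_def], folded PP_def, folded \<beta>_def \<Psi>_def]
    by blast+
  have \<Phi>: "\<Phi> i \<in> carrier_mat m m" "(\<Phi> i)\<^sup>T = \<Phi> i" "\<Phi> i * \<Phi> i = \<Phi> i" if "i < r1" for i
  proof -
    have "A\<^sup>T * Ss i \<in> carrier_mat m (\<tau>1 i)" "full_row_rank ((A\<^sup>T * Ss i)\<^sup>T)"
      using A S[OF that] by (auto simp: transpose_mult_dim)
    from gram_projection[OF this] show "\<Phi> i \<in> carrier_mat m m" "(\<Phi> i)\<^sup>T = \<Phi> i" "\<Phi> i * \<Phi> i = \<Phi> i"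
      by (simp_all add: \<Phi>_def)
  qed
  have \<Psi>: "\<Psi> j \<in> carrier_mat n n" "(\<Psi> j)\<^sup>T = \<Psi> j" "\<Psi> j * \<Psi> j = \<Psi> j" if "j < r2" for j
  proof -
    have "B * Ps j \<in> carrier_mat n (\<tau>2 j)" "full_row_rank ((B * Ps j)\<^sup>T)"
      using B P[OF that] by (auto simp: transpose_mult_dim)
    from gram_projection[OF this] show "\<Psi> j \<in> carrier_mat n n" "(\<Psi> j)\<^sup>T = \<Psi> j" "\<Psi> j * \<Psi> j = \<Psi> j"
      by (simp_all add: \<Psi>_def)
  qed
  have step: "sampling_step A B C (Ss i) (Ps j) x - Xstar = (x - Xstar) - \<Phi> i * (x - Xstar) * \<Psi> j"
    if "x \<in> carrier_mat m n" "i < r1" "j < r2" for x i j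
    using sampling_step_error[OF A B _ _ _ _ that(1) Xstar(1), of "Ss i" "\<tau>1 i" "Ps j" "\<tau>2 j"]
      S[OF that(2)] P[OF that(3)] by (simp add: Xstar(2) \<Phi>_def \<Psi>_def)
  have \<alpha>\<beta>: "\<rho> = 1 - \<alpha> * \<beta>" by (simp add: \<rho> \<alpha>_def \<beta>_def)
  \<comment> \<open>Iterating the contraction multiplies inequalities by powers of \<rho>.\<close>
  have \<rho>_nonneg: "0 \<le> \<rho>"
    using mult_le_one[OF left(2) right(1,2)] by (simp add: \<alpha>\<beta>)
  show ?thesis
  proof (rule expectation_random_iteration_le[where I = I and J = J and X = X and D = "carrier_mat m n"
        and V = "\<lambda>x. (frobenius_norm (x - Xstar))\<^sup>2"
        and step = "\<lambda>i j. sampling_step A B C (Ss i) (Ps j)",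
        OF indep I J sum1 sum2 X_0 X_Suc \<rho>_nonneg X0])
    \<comment> \<open>A difference has the dimensions of its subtrahend, here fixed by the outer
      factors \<open>A\<^sup>T\<close> and \<open>B\<^sup>T\<close>.\<close>
    show "sampling_step A B C (Ss i) (Ps j) x \<in> carrier_mat m n"
      if "x \<in> carrier_mat m n" "i < r1" "j < r2" for x i j
      using that A B by (auto simp: sampling_step_def intro!: carrier_matI)
  next
    fix x :: "real mat" assume x: "x \<in> carrier_mat m n"
    define Y where "Y = x - Xstar"
    have Y: "Y \<in> carrier_mat m n" unfolding Y_def by (rule minus_carrier_mat[OF Xstar(1)])
    \<comment> \<open>Transposition preserves the norm and moves the symmetric
      \<open>\<Psi> j\<close> to the left, where \<open>right_le\<close> applies.\<close>
    have right_le': "\<beta> * (frobenius_norm Z)\<^sup>2 \<le> (\<Sum>j<r2. p2 j * (frobenius_norm (Z * \<Psi> j))\<^sup>2)"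
      if Z: "Z \<in> carrier_mat m n" for Z
    proof -
      have "frobenius_norm (Z * \<Psi> j) = frobenius_norm (\<Psi> j * Z\<^sup>T)" if "j < r2" for j
        using \<Psi>[OF that] Z frobenius_norm_transpose[of "Z * \<Psi> j"] by (simp add: transpose_mult_dim)
      then show ?thesis using right_le[of "Z\<^sup>T" m] Z by simp
    qed
    \<comment> \<open>The bounds are nested: the left one for \<open>Y\<close>, then for each
      \<open>i\<close> the right one for \<open>\<Phi> i * Y\<close>.\<close>
    have "\<alpha> * \<beta> * (frobenius_norm Y)\<^sup>2 \<le> \<beta> * (\<Sum>i<r1. p1 i * (frobenius_norm (\<Phi> i * Y))\<^sup>2)"
      using mult_left_mono[OF left_le[OF Y] right(1)] by (simp add: mult_ac)
    also have "\<dots> = (\<Sum>i<r1. p1 i * (\<beta> * (frobenius_norm (\<Phi> i * Y))\<^sup>2))"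
      by (simp add: sum_distrib_left mult.left_commute)
    also have "\<dots> \<le> (\<Sum>i<r1. p1 i * (\<Sum>j<r2. p2 j * (frobenius_norm (\<Phi> i * Y * \<Psi> j))\<^sup>2))"
      using S \<Phi>(1) Y by (intro sum_mono mult_left_mono right_le') (auto intro: less_imp_le mult_carrier_mat)
    finally have gain: "\<alpha> * \<beta> * (frobenius_norm Y)\<^sup>2
        \<le> (\<Sum>i<r1. \<Sum>j<r2. p1 i * p2 j * (frobenius_norm (\<Phi> i * Y * \<Psi> j))\<^sup>2)"
      by (simp add: sum_distrib_left mult.assoc)
    \<comment> \<open>Pythagoras holds for each pair of indices; since the weights sum to 1, the
      average loses exactly the quantity bounded in \<open>gain\<close>.\<close>
    have "(\<Sum>i<r1. \<Sum>j<r2. p1 i * p2 j * (frobenius_norm (sampling_step A B C (Ss i) (Ps j) x - Xstar))\<^sup>2)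
        = (\<Sum>i<r1. \<Sum>j<r2. p1 i * p2 j * (frobenius_norm Y)\<^sup>2
            - p1 i * p2 j * (frobenius_norm (\<Phi> i * Y * \<Psi> j))\<^sup>2)"
    proof (intro sum.cong refl)
      fix i j assume "i \<in> {..<r1}" "j \<in> {..<r2}"
      then have ij: "i < r1" "j < r2" by auto
      show "p1 i * p2 j * (frobenius_norm (sampling_step A B C (Ss i) (Ps j) x - Xstar))\<^sup>2
          = p1 i * p2 j * (frobenius_norm Y)\<^sup>2
            - p1 i * p2 j * (frobenius_norm (\<Phi> i * Y * \<Psi> j))\<^sup>2"
        using frobenius_norm_two_sided_projection[OF \<Phi>[OF ij(1)] \<Psi>[OF ij(2)] Y]
        by (simp add: step[OF x ij] Y_def[symmetric] right_diff_distrib)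
    qed
    also have "\<dots> = (frobenius_norm Y)\<^sup>2
        - (\<Sum>i<r1. \<Sum>j<r2. p1 i * p2 j * (frobenius_norm (\<Phi> i * Y * \<Psi> j))\<^sup>2)"
      using sum1 sum2 by (simp add: sum_subtractf sum_distrib_right[symmetric] sum_distrib_left[symmetric])
    also have "\<dots> \<le> \<rho> * (frobenius_norm Y)\<^sup>2"
      using gain by (simp add: \<alpha>\<beta> left_diff_distrib)
    finally show "(\<Sum>i<r1. \<Sum>j<r2. p1 i * p2 j
          * (frobenius_norm (sampling_step A B C (Ss i) (Ps j) x - Xstar))\<^sup>2)
        \<le> \<rho> * (frobenius_norm (x - Xstar))\<^sup>2"
      by (simp add: Y_def)
  qed
qed

end
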